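(* Let $q$ be a timelike split quaternion with timelike vector part, written in the form $q=N_q(\cos\theta+\overrightarrow{\varepsilon}\sin\theta)$, where $\theta\in\mathbb{R}$ and $\overrightarrow{\varepsilon}=(u_1,u_2,u_3)=u_1i+u_2j+u_3k$ is a timelike unit vector in $\mathbb{E}_1^3$. Then for every positive integer $n$, $$(\mathbf{L}_q)^n=(N_q)^n\begin{bmatrix}\cos n\theta&-u_1\sin n\theta&u_2\sin n\theta&u_3\sin n\theta\\ u_1\sin n\theta&\cos n\theta&u_3\sin n\theta&-u_2\sin n\theta\\ u_2\sin n\theta&u_3\sin n\theta&\cos n\theta&-u_1\sin n\theta\\ u_3\sin n\theta&-u_2\sin n\theta&u_1\sin n\theta&\cos n\theta\end{bmatrix}=(N_q)^n[\cos n\theta\,\mathbf{I}_4+\sin n\theta\,\mathbf{L}_{\overrightarrow{\varepsilon}}],$$ $$(\mathbf{R}_q)^n=(N_q)^n\begin{bmatrix}\cos n\theta&-u_1\sin n\theta&u_2\sin n\theta&u_3\sin n\theta\\ u_1\sin n\theta&\cos n\theta&-u_3\sin n\theta&u_2\sin n\theta\\ u_2\sin n\theta&-u_3\sin n\theta&\cos n\theta&u_1\sin n\theta\\ u_3\sin n\theta&u_2\sin n\theta&-u_1\sin n\theta&\cos n\theta\end{bmatrix}=(N_q)^n[\cos n\theta\,\mathbf{I}_4+\sin n\theta\,\mathbf{R}_{\overrightarrow{\varepsilon}}].$$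
   Context: The split quaternions $\widehat{\mathbb{H}}$ form the real associative algebra with basis $\{1,i,j,k\}$ and products $i^2=-1$, $j^2=k^2=1$, $ij=k=-ji$, $jk=-i=-kj$, $ki=j=-ik$. For $q=q_0+q_1i+q_2j+q_3k$, the vector part is $\overrightarrow{V_q}=q_1i+q_2j+q_3k$, and $I_q=q_0^2+q_1^2-q_2^2-q_3^2$, $N_q=\sqrt{|I_q|}$. The split quaternion $q$ is timelike if $I_q>0$, spacelike if $I_q<0$, lightlike if $I_q=0$. Pure split quaternions (those with $q_0=0$) $u_1i+u_2j+u_3k$ are identified with vectors $(u_1,u_2,u_3)$ of Minkowski 3-space $\mathbb{E}_1^3$, i.e. $\mathbb{R}^3$ with $\langle u,v\rangle_{\mathbb{L}}=-u_1v_1+u_2v_2+u_3v_3$. A vector $u$ is spacelike if $\langle u,u\rangle_{\mathbb{L}}>0$ and timelike if $\langle u,u\rangle_{\mathbb{L}}<0$; a spacelike unit vector satisfies $\langle u,u\rangle_{\mathbb{L}}=1$ and a timelike unit vector satisfies $\langle u,u\rangle_{\mathbb{L}}=-1$. The left and right matrix representations of $q$ (matrices of $p\mapsto qp$ and $p\mapsto pq$ in the basis $1,i,j,k$) are $$\mathbf{L}_q=\begin{bmatrix}q_0&-q_1&q_2&q_3\\ q_1&q_0&q_3&-q_2\\ q_2&q_3&q_0&-q_1\\ q_3&-q_2&q_1&q_0\end{bmatrix},\qquad \mathbf{R}_q=\begin{bmatrix}q_0&-q_1&q_2&q_3\\ q_1&q_0&-q_3&q_2\\ q_2&-q_3&q_0&q_1\\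 q_3&q_2&-q_1&q_0\end{bmatrix}.$$ $\mathbf{I}_4$ is the $4\times4$ identity matrix. *)

theory Defs
  imports "HOL-Analysis.Analysis"
begin

datatype split_quat = SQ (Q0: real) (Q1: real) (Q2: real) (Q3: real)

lemma split_quat_eqI:
  "Q0 p = Q0 q \<Longrightarrow> Q1 p = Q1 q \<Longrightarrow> Q2 p = Q2 q \<Longrightarrow> Q3 p = Q3 q \<Longrightarrow> p = q"
  by (rule split_quat.expand) simp

instantiation split_quat :: real_algebra_1
begin

definition "0 = SQ 0 0 0 0"
definition "1 = SQ 1 0 0 0"
definition "p + q = SQ (Q0 p + Q0 q) (Q1 p + Q1 q) (Q2 p + Q2 q) (Q3 p + Q3 q)"
definition "- p = SQ (- Q0 p) (- Q1 p) (- Q2 p) (- Q3 p)"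
definition "p - q = SQ (Q0 p - Q0 q) (Q1 p - Q1 q) (Q2 p - Q2 q) (Q3 p - Q3 q)"
definition "r *\<^sub>R q = SQ (r * Q0 q) (r * Q1 q) (r * Q2 q) (r * Q3 q)"

(* bilinear extension of i^2 = -1, j^2 = k^2 = 1, ij = k = -ji, jk = -i = -kj, ki = j = -ik *)
definition "p * q = SQ
  (Q0 p * Q0 q - Q1 p * Q1 q + Q2 p * Q2 q + Q3 p * Q3 q)
  (Q0 p * Q1 q + Q1 p * Q0 q - Q2 p * Q3 q + Q3 p * Q2 q)
  (Q0 p * Q2 q + Q2 p * Q0 q - Q1 p * Q3 q + Q3 p * Q1 q)
  (Q0 p * Q3 q + Q3 p * Q0 q + Q1 p * Q2 q - Q2 p * Q1 q)"

lemmas split_quat_ops_defs =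
  zero_split_quat_def one_split_quat_def plus_split_quat_def uminus_split_quat_def
  minus_split_quat_def scaleR_split_quat_def times_split_quat_def

instance
  by standard (simp_all add: split_quat_ops_defs algebra_simps)

end

definition qi :: split_quat where "qi = SQ 0 1 0 0"
definition qj :: split_quat where "qj = SQ 0 0 1 0"
definition qk :: split_quat where "qk = SQ 0 0 0 1"

lemma split_quat_basis_products:
  "qi * qi = - 1" "qj * qj = 1" "qk * qk = 1"
  "qi * qj = qk" "qj * qi = - qk"
  "qj * qk = - qi" "qk * qj = qi"
  "qk * qi = qj" "qi * qk = - qj"
  by (simp_all add: qi_def qj_def qk_def split_quat_ops_defs)

lemma split_quat_basis_expansion:
  "q = of_real (Q0 q) + Q1 q *\<^sub>R qi + Q2 q *\<^sub>R qj + Q3 q *\<^sub>R qk"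
  by (rule split_quat_eqI) (simp_all add: of_real_def qi_def qj_def qk_def split_quat_ops_defs)

definition quat_form :: "split_quat \<Rightarrow> real" where
  "quat_form q = (Q0 q)\<^sup>2 + (Q1 q)\<^sup>2 - (Q2 q)\<^sup>2 - (Q3 q)\<^sup>2"

definition quat_norm :: "split_quat \<Rightarrow> real" where
  "quat_norm q = sqrt \<bar>quat_form q\<bar>"

definition timelike_quat :: "split_quat \<Rightarrow> bool" where
  "timelike_quat q \<longleftrightarrow> quat_form q > 0"

definition lorentz_inner :: "real ^ 3 \<Rightarrow> real ^ 3 \<Rightarrow> real" where
  "lorentz_inner u v = - (u $ 1 * v $ 1) + u $ 2 * v $ 2 + u $ 3 * v $ 3"

definition timelike_vec :: "real ^ 3 \<Rightarrow> bool" where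
  "timelike_vec u \<longleftrightarrow> lorentz_inner u u < 0"

definition timelike_unit_vec :: "real ^ 3 \<Rightarrow> bool" where
  "timelike_unit_vec u \<longleftrightarrow> lorentz_inner u u = - 1"

definition vector_part :: "split_quat \<Rightarrow> real ^ 3" where
  "vector_part q = vector [Q1 q, Q2 q, Q3 q]"

(* the identification of Minkowski 3-space with the pure split quaternions *)
definition pure_quat :: "real ^ 3 \<Rightarrow> split_quat" where
  "pure_quat u = u $ 1 *\<^sub>R qi + u $ 2 *\<^sub>R qj + u $ 3 *\<^sub>R qk"

definition left_mat :: "split_quat \<Rightarrow> real ^ 4 ^ 4" where
  "left_mat q = vector [
     vector [Q0 q, - Q1 q,   Q2 q,   Q3 q],
     vector [Q1 q,   Q0 q,   Q3 q, - Q2 q],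
     vector [Q2 q,   Q3 q,   Q0 q, - Q1 q],
     vector [Q3 q, - Q2 q,   Q1 q,   Q0 q]]"

definition right_mat :: "split_quat \<Rightarrow> real ^ 4 ^ 4" where
  "right_mat q = vector [
     vector [Q0 q, - Q1 q,   Q2 q,   Q3 q],
     vector [Q1 q,   Q0 q, - Q3 q,   Q2 q],
     vector [Q2 q, - Q3 q,   Q0 q,   Q1 q],
     vector [Q3 q,   Q2 q, - Q1 q,   Q0 q]]"

definition quat_coords :: "split_quat \<Rightarrow> real ^ 4" where
  "quat_coords q = vector [Q0 q, Q1 q, Q2 q, Q3 q]"

lemma vector_4_nth [simp]:
  fixes a b c d :: "'a :: zero"
  shows "(vector [a, b, c, d] :: 'a ^ 4) $ 1 = a"
    and "(vector [a, b, c, d] :: 'a ^ 4) $ 2 = b"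
    and "(vector [a, b, c, d] :: 'a ^ 4) $ 3 = c"
    and "(vector [a, b, c, d] :: 'a ^ 4) $ 4 = d"
  by (simp_all add: vector_def)

lemma left_mat_mult_coords: "left_mat q *v quat_coords p = quat_coords (q * p)"
  by (simp add: vec_eq_iff forall_4 matrix_vector_mult_def sum_4 left_mat_def quat_coords_def
      times_split_quat_def algebra_simps)

lemma right_mat_mult_coords: "right_mat q *v quat_coords p = quat_coords (p * q)"
  by (simp add: vec_eq_iff forall_4 matrix_vector_mult_def sum_4 right_mat_def quat_coords_def
      times_split_quat_def algebra_simps)

(* Power with respect to the matrix product; the library's ^ on vec types is componentwise. *)
primrec mat_power :: "real ^ 'n ^ 'n \<Rightarrow> nat \<Rightarrow> real ^ 'n ^ 'n" where
  "mat_power A 0 = mat 1"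
| "mat_power A (Suc n) = A ** mat_power A n"

end

theory Submission
  imports Defs
begin

text \<open>
  A timelike unit vector, read as a pure split quaternion \<open>\<epsilon>\<close>, satisfies \<open>\<epsilon>\<^sup>2 = - 1\<close>. Hence \<open>1\<close> and \<open>\<epsilon>\<close>
  span a copy of the complex numbers inside the split quaternions, and De Moivre's formula
  (\<open>de_moivre_square_minus_one\<close>) computes the powers of \<open>q = N (cos \<theta> + \<epsilon> sin \<theta>)\<close> there, giving
  \<open>q ^ n = N ^ n (cos n\<theta> + \<epsilon> sin n\<theta>)\<close>.

  The matrices \<open>L\<^sub>q\<close> and \<open>R\<^sub>q\<close> describe multiplication by \<open>q\<close> on the left and on the right, so
  associativity makes \<open>q \<mapsto> L\<^sub>q\<close> a homomorphism and \<open>q \<mapsto> R\<^sub>q\<close> an antihomomorphism of algebras. Powers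
  of a single element commute, so both maps carry \<open>q ^ n\<close> to the \<open>n\<close>-th matrix power
  (\<open>mat_power_left_mat\<close>, \<open>mat_power_right_mat\<close>). By linearity they carry the polar form of \<open>q ^ n\<close> to
  the asserted combinations of the identity matrix with \<open>L\<^sub>\<epsilon>\<close> and \<open>R\<^sub>\<epsilon>\<close>; the explicit matrices are
  their entries.
\<close>

text \<open>
  An element with square \<open>- 1\<close> multiplies like the imaginary unit, so the inductive step is exactly
  the pair of addition theorems for cosine and sine.
\<close>

lemma de_moivre_square_minus_one:
  fixes e :: "'a :: real_algebra_1"
  assumes "e * e = - 1"
  shows "(of_real (cos \<theta>) + sin \<theta> *\<^sub>R e) ^ n = of_real (cos (n * \<theta>)) + sin (n * \<theta>) *\<^sub>R e"
proof (induction n)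
  case 0
  show ?case by simp
next
  case (Suc n)
  have angle: "real (Suc n) * \<theta> = \<theta> + n * \<theta>"
    by (simp add: algebra_simps)
  show ?case
    unfolding power_Suc Suc.IH angle cos_add sin_add
    using assms by (simp add: of_real_def algebra_simps)
qed

lemma power_scaleR_real_algebra_1:
  fixes x :: "'a :: real_algebra_1"
  shows "(r *\<^sub>R x) ^ n = r ^ n *\<^sub>R x ^ n"
  by (induction n) (simp_all add: ac_simps)

lemma pure_quat_timelike_unit_square:
  assumes "timelike_unit_vec u"
  shows "pure_quat u * pure_quat u = - 1"
  using assms
  by (simp add: timelike_unit_vec_def lorentz_inner_def pure_quat_def qi_def qj_def qk_def
      split_quat_ops_defs)

lemma left_mat_one: "left_mat 1 = mat 1"
  by (simp add: vec_eq_iff forall_4 mat_def left_mat_def one_split_quat_def)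

lemma right_mat_one: "right_mat 1 = mat 1"
  by (simp add: vec_eq_iff forall_4 mat_def right_mat_def one_split_quat_def)

lemma left_mat_mult: "left_mat (p * q) = left_mat p ** left_mat q"
  by (simp add: vec_eq_iff forall_4 matrix_matrix_mult_def sum_4 left_mat_def
      times_split_quat_def algebra_simps)

text \<open>
  The order is reversed because multiplying on the right by \<open>p * q\<close> applies \<open>p\<close> first.
\<close>

lemma right_mat_mult: "right_mat (p * q) = right_mat q ** right_mat p"
  by (simp add: vec_eq_iff forall_4 matrix_matrix_mult_def sum_4 right_mat_def
      times_split_quat_def algebra_simps)

lemma left_mat_add: "left_mat (p + q) = left_mat p + left_mat q"
  by (simp add: vec_eq_iff forall_4 left_mat_def plus_split_quat_def)

lemma right_mat_add: "right_mat (p + q) = right_mat p + right_mat q"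
  by (simp add: vec_eq_iff forall_4 right_mat_def plus_split_quat_def)

lemma left_mat_scaleR: "left_mat (r *\<^sub>R q) = r *\<^sub>R left_mat q"
  by (simp add: vec_eq_iff forall_4 left_mat_def scaleR_split_quat_def)

lemma right_mat_scaleR: "right_mat (r *\<^sub>R q) = r *\<^sub>R right_mat q"
  by (simp add: vec_eq_iff forall_4 right_mat_def scaleR_split_quat_def)

lemma mat_power_left_mat: "mat_power (left_mat q) n = left_mat (q ^ n)"
  by (induction n) (simp_all add: left_mat_one left_mat_mult)

text \<open>
  An antihomomorphism preserves powers too: peeling the last factor off \<open>q ^ Suc n\<close> instead of the
  first undoes the reversal.
\<close>

lemma mat_power_right_mat: "mat_power (right_mat q) n = right_mat (q ^ n)"
  by (induction n) (simp_all add: right_mat_one right_mat_mult power_Suc2 del: power_Suc)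

lemma pure_quat_sel:
  "Q0 (pure_quat u) = 0" "Q1 (pure_quat u) = u $ 1"
  "Q2 (pure_quat u) = u $ 2" "Q3 (pure_quat u) = u $ 3"
  by (simp_all add: pure_quat_def qi_def qj_def qk_def split_quat_ops_defs)

theorem theorem4:
  fixes q :: split_quat and \<theta> :: real and \<epsilon> :: "real ^ 3" and n :: nat
  assumes "timelike_quat q"
    and "timelike_vec (vector_part q)"
    and "timelike_unit_vec \<epsilon>"
    and "q = quat_norm q *\<^sub>R (of_real (cos \<theta>) + sin \<theta> *\<^sub>R pure_quat \<epsilon>)"
    and "n > 0"
  shows
    "mat_power (left_mat q) n = quat_norm q ^ n *\<^sub>R vector [
       vector [cos (n * \<theta>), - \<epsilon> $ 1 * sin (n * \<theta>), \<epsilon> $ 2 * sin (n * \<theta>), \<epsilon> $ 3 * sin (n * \<theta>)],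
       vector [\<epsilon> $ 1 * sin (n * \<theta>), cos (n * \<theta>), \<epsilon> $ 3 * sin (n * \<theta>), - \<epsilon> $ 2 * sin (n * \<theta>)],
       vector [\<epsilon> $ 2 * sin (n * \<theta>), \<epsilon> $ 3 * sin (n * \<theta>), cos (n * \<theta>), - \<epsilon> $ 1 * sin (n * \<theta>)],
       vector [\<epsilon> $ 3 * sin (n * \<theta>), - \<epsilon> $ 2 * sin (n * \<theta>), \<epsilon> $ 1 * sin (n * \<theta>), cos (n * \<theta>)]]
     \<and>
     mat_power (left_mat q) n =
       quat_norm q ^ n *\<^sub>R (cos (n * \<theta>) *\<^sub>R mat 1 + sin (n * \<theta>) *\<^sub>R left_mat (pure_quat \<epsilon>))
     \<and>
     mat_power (right_mat q) n = quat_norm q ^ n *\<^sub>R vector [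
       vector [cos (n * \<theta>), - \<epsilon> $ 1 * sin (n * \<theta>), \<epsilon> $ 2 * sin (n * \<theta>), \<epsilon> $ 3 * sin (n * \<theta>)],
       vector [\<epsilon> $ 1 * sin (n * \<theta>), cos (n * \<theta>), - \<epsilon> $ 3 * sin (n * \<theta>), \<epsilon> $ 2 * sin (n * \<theta>)],
       vector [\<epsilon> $ 2 * sin (n * \<theta>), - \<epsilon> $ 3 * sin (n * \<theta>), cos (n * \<theta>), \<epsilon> $ 1 * sin (n * \<theta>)],
       vector [\<epsilon> $ 3 * sin (n * \<theta>), \<epsilon> $ 2 * sin (n * \<theta>), - \<epsilon> $ 1 * sin (n * \<theta>), cos (n * \<theta>)]]
     \<and>
     mat_power (right_mat q) n =
       quat_norm q ^ n *\<^sub>R (cos (n * \<theta>) *\<^sub>R mat 1 + sin (n * \<theta>) *\<^sub>R right_mat (pure_quat \<epsilon>))"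
proof -
  have "q ^ n = (quat_norm q *\<^sub>R (of_real (cos \<theta>) + sin \<theta> *\<^sub>R pure_quat \<epsilon>)) ^ n"
    using assms(4) by (rule arg_cong)
  also have "\<dots> = quat_norm q ^ n *\<^sub>R (cos (n * \<theta>) *\<^sub>R 1 + sin (n * \<theta>) *\<^sub>R pure_quat \<epsilon>)"
    unfolding power_scaleR_real_algebra_1
      de_moivre_square_minus_one[OF pure_quat_timelike_unit_square[OF assms(3)]]
    by (simp only: of_real_def)
  finally have polar: "q ^ n = \<dots>" .
  have left: "mat_power (left_mat q) n =
      quat_norm q ^ n *\<^sub>R (cos (n * \<theta>) *\<^sub>R mat 1 + sin (n * \<theta>) *\<^sub>R left_mat (pure_quat \<epsilon>))"
    unfolding mat_power_left_mat polar left_mat_scaleR left_mat_add left_mat_one ..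
  have right: "mat_power (right_mat q) n =
      quat_norm q ^ n *\<^sub>R (cos (n * \<theta>) *\<^sub>R mat 1 + sin (n * \<theta>) *\<^sub>R right_mat (pure_quat \<epsilon>))"
    unfolding mat_power_right_mat polar right_mat_scaleR right_mat_add right_mat_one ..
  show ?thesis
    unfolding left right
    by (simp add: vec_eq_iff forall_4 mat_def left_mat_def right_mat_def pure_quat_sel)
qed

end
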